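(* Let $\alpha,\beta\in[-1,1]$ with $\alpha^2+\beta^2=1$ and $\beta\neq0$, and let $\alpha_0=1$, $\beta_0=0$, $\alpha_n=\alpha$ and $\beta_n=\beta$ for all $n\ge1$. Let $\psi$ be the pure state on $M_2(\mathbb C)$ with parameters $0<\lambda<1$ and $\zeta\in\mathbb C$, $|\zeta|=1$, and let $T_\psi$ be the associated transition operator on $\mathcal B(\mathcal H)$, $\mathcal H=\ell^2(\mathbb N)$. Then $T_\psi$ admits a pure invariant normal state if and only if $\lambda<\tfrac12(1-\alpha)$. In this case there is only one pure invariant normal state $\varphi$ on $\mathcal B(\mathcal H)$, and it is given by $$\varphi(x)=\langle x\xi,\xi\rangle\quad\text{with}\quad \xi=\sqrt{1-|q|^2}\cdot(q^n)_{n\in\mathbb N}\quad\text{and}\quad q=-i\zeta\,\frac{\beta}{1-\alpha}\sqrt{\frac{\lambda}{1-\lambda}}.$$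
   Context: $\mathbb N$ includes $0$. $\mathcal H=\ell^2(\mathbb N)$ has canonical orthonormal basis $(e_n)_{n\in\mathbb N}$; scalar products are linear in the first component; $\mathbf 1$ is the identity operator. Let $a,b\in\mathcal B(\mathcal H)$ be the diagonal operators $a e_n=\alpha_n e_n$, $b e_n=\beta_n e_n$, and let $s$ be the isometric shift $s e_n=e_{n+1}$. Writing operators on $\mathcal H\otimes\mathbb C^2$ as $2\times2$ matrices with entries in $\mathcal B(\mathcal H)$ (so $x\otimes y=(y_{i,j}x)_{i,j}$), define the unitary $$u=\begin{pmatrix} s^*as & i s^*b\\ i bs & a\end{pmatrix}.$$ For a state $\psi$ on $M_2=M_2(\mathbb C)$ let $P_\psi:\mathcal B(\mathcal H\otimes\mathbb C^2)\to\mathcal B(\mathcal H)$ be the linear extension of $P_\psi(x\otimes y)=\psi(y)x$. The transition operator associated with $\psi$ is $T_\psi(x)=P_\psi\bigl(u^*(x\otimes\mathbf 1)u\bigr)$, $x\in\mathcal B(\mathcal H)$. The state $\psi$ with parameters $\lambda\in[0,1]$ and $\zeta\in\mathbb C$, $|\zeta|\le1$, is $\psi(y)=\mathrm{Tr}(\rho y)$ with $$\rho=\begin{pmatrix}\lambda & \bar\zeta\sqrt{\lambda(1-\lambda)}\\ \zeta\sqrt{\lambda(1-\lambda)} & 1-\lambda\end{pmatrix}.$$ A pure normal state on $\mathcal B(\mathcal H)$ is a vector state $x\mapsto\langle x\xi,\xi\rangle$ with $\|\xi\|=1$; a state $\varphi$ is invariant for $T_\psi$ if $\varphi\circ T_\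psi=\varphi$.
   Formalization: The printed q is replaced by its complex conjugate, q = i·conj(ζ)·β/(1-α)·√(λ/(1-λ)); under the stated conventions the printed q gives a non-invariant state unless ζ = ±i (e.g. α=0, β=1, λ=1/5, ζ=1 needs q = i/2, not -i/2). *)

theory Defs
  imports "HOL-Analysis.Analysis"
begin

section \<open>The Hilbert space \<open>\<ell>\<^sup>2(\<nat>)\<close>\<close>

typedef ell2 = "{f :: nat \<Rightarrow> complex. summable (\<lambda>n. (cmod (f n))\<^sup>2)}"
  morphisms coord Abs_ell2
  by (rule exI[of _ "\<lambda>_. 0"]) simp

setup_lifting type_definition_ell2

lemma summable_coord_sq: "summable (\<lambda>n. (cmod (coord x n))\<^sup>2)"
  using coord[of x] by simp

lemma ell2_eqI: "(\<And>n. coord x n = coord y n) \<Longrightarrow> x = y"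
  using coord_inject by blast

lemma summable_sq_add:
  fixes f g :: "nat \<Rightarrow> complex"
  assumes "summable (\<lambda>n. (cmod (f n))\<^sup>2)" "summable (\<lambda>n. (cmod (g n))\<^sup>2)"
  shows "summable (\<lambda>n. (cmod (f n + g n))\<^sup>2)"
proof (rule summable_comparison_test')
  show "summable (\<lambda>n. 2 * (cmod (f n))\<^sup>2 + 2 * (cmod (g n))\<^sup>2)"
    using assms by (intro summable_add summable_mult)
  fix n :: nat
  have "(cmod (f n + g n))\<^sup>2 \<le> (cmod (f n) + cmod (g n))\<^sup>2"
    by (intro power_mono norm_triangle_ineq) simp
  also have "\<dots> \<le> 2 * (cmod (f n))\<^sup>2 + 2 * (cmod (g n))\<^sup>2"
    using sum_squares_bound[of "cmod (f n)" "cmod (g n)"] by (simp add: power2_sum)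
  finally show "norm ((cmod (f n + g n))\<^sup>2) \<le> 2 * (cmod (f n))\<^sup>2 + 2 * (cmod (g n))\<^sup>2"
    by simp
qed

lemma summable_sq_mult_bounded:
  fixes d f :: "nat \<Rightarrow> complex"
  assumes "Bseq d" "summable (\<lambda>n. (cmod (f n))\<^sup>2)"
  shows "summable (\<lambda>n. (cmod (d n * f n))\<^sup>2)"
proof -
  from assms(1) obtain K where K: "\<And>n. cmod (d n) \<le> K" by (auto simp: Bseq_def)
  show ?thesis
  proof (rule summable_comparison_test')
    show "summable (\<lambda>n. K\<^sup>2 * (cmod (f n))\<^sup>2)"
      using assms(2) by (rule summable_mult)
    fix n :: nat
    have "(cmod (d n))\<^sup>2 \<le> K\<^sup>2" using K[of n] by (intro power_mono) auto
    then show "norm ((cmod (d n * f n))\<^sup>2) \<le> K\<^sup>2 * (cmod (f n))\<^sup>2"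
      by (simp add: norm_mult power_mult_distrib mult_right_mono)
  qed
qed

lemma Bseq_const_seq: "Bseq (\<lambda>_. c :: complex)"
  by (rule BseqI'[where K = "norm c"]) simp

instantiation ell2 :: real_vector
begin

lift_definition zero_ell2 :: ell2 is "\<lambda>_. 0" by simp
lift_definition plus_ell2 :: "ell2 \<Rightarrow> ell2 \<Rightarrow> ell2" is "\<lambda>f g n. f n + g n"
  by (rule summable_sq_add)
lift_definition uminus_ell2 :: "ell2 \<Rightarrow> ell2" is "\<lambda>f n. - f n" by simp
lift_definition minus_ell2 :: "ell2 \<Rightarrow> ell2 \<Rightarrow> ell2" is "\<lambda>f g n. f n - g n"
  subgoal for f g using summable_sq_add[of f "\<lambda>n. - g n"] by simp
  done
lift_definition scaleR_ell2 :: "real \<Rightarrow> ell2 \<Rightarrow> ell2" is "\<lambda>r f n. of_real r * f n"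
  by (rule summable_sq_mult_bounded[OF Bseq_const_seq])

instance
  by standard (transfer; simp add: algebra_simps fun_eq_iff)+

end

class scaleC =
  fixes scaleC :: "complex \<Rightarrow> 'a \<Rightarrow> 'a"  (infixr "*\<^sub>C" 75)

instantiation ell2 :: scaleC
begin
lift_definition scaleC_ell2 :: "complex \<Rightarrow> ell2 \<Rightarrow> ell2" is "\<lambda>c f n. c * f n"
  by (rule summable_sq_mult_bounded[OF Bseq_const_seq])
instance ..
end

lemma coord_simps [simp]:
  "coord 0 n = 0" "coord (x + y) n = coord x n + coord y n"
  "coord (- x) n = - coord x n" "coord (x - y) n = coord x n - coord y n"
  "coord (r *\<^sub>R x) n = of_real r * coord x n" "coord (c *\<^sub>C x) n = c * coord x n"
  by (transfer; simp)+

text \<open>The scalar product is linear in the first component.\<close>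

definition cinner :: "ell2 \<Rightarrow> ell2 \<Rightarrow> complex" where
  "cinner x y = (\<Sum>n. coord x n * cnj (coord y n))"

lemma summable_cinner: "summable (\<lambda>n. coord x n * cnj (coord y n))"
proof (rule summable_comparison_test')
  show "summable (\<lambda>n. (cmod (coord x n))\<^sup>2 + (cmod (coord y n))\<^sup>2)"
    by (intro summable_add summable_coord_sq)
  fix n :: nat
  have "2 * (cmod (coord x n) * cmod (coord y n)) \<le> (cmod (coord x n))\<^sup>2 + (cmod (coord y n))\<^sup>2"
    using sum_squares_bound[of "cmod (coord x n)" "cmod (coord y n)"] by simp
  moreover have "0 \<le> cmod (coord x n) * cmod (coord y n)" by simp
  ultimately show "norm (coord x n * cnj (coord y n)) \<le> (cmod (coord x n))\<^sup>2 + (cmod (coord y n))\<^sup>2"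
    unfolding norm_mult complex_mod_cnj by linarith
qed

lemma cinner_add_left: "cinner (x + y) z = cinner x z + cinner y z"
  by (simp add: cinner_def algebra_simps suminf_add[symmetric] summable_cinner)

lemma cinner_scaleC_left: "cinner (c *\<^sub>C x) y = c * cinner x y"
  by (simp add: cinner_def suminf_mult[symmetric] summable_cinner mult.assoc)

lemma cinner_commute: "cinner x y = cnj (cinner y x)"
  unfolding cinner_def
  by (subst bounded_linear.suminf[OF bounded_linear_cnj])
    (simp_all add: summable_cinner mult.commute)

lemma cinner_add_right: "cinner x (y + z) = cinner x y + cinner x z"
  by (metis cinner_add_left cinner_commute complex_cnj_add)

lemma cinner_scaleC_right: "cinner x (c *\<^sub>C y) = cnj c * cinner x y"
  by (metis cinner_scaleC_left cinner_commute complex_cnj_mult)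

lemma scaleR_scaleC_ell2: "r *\<^sub>R (x :: ell2) = of_real r *\<^sub>C x"
  by (rule ell2_eqI) simp

lemma cinner_self: "cinner x x = of_real (\<Sum>n. (cmod (coord x n))\<^sup>2)"
  unfolding cinner_def
  by (simp add: complex_norm_square[symmetric] suminf_of_real summable_coord_sq
      flip: of_real_power)

instantiation ell2 :: real_inner
begin

definition inner_ell2 :: "ell2 \<Rightarrow> ell2 \<Rightarrow> real" where "inner_ell2 x y = Re (cinner x y)"
definition norm_ell2 :: "ell2 \<Rightarrow> real" where "norm_ell2 x = sqrt (inner x x)"
definition sgn_ell2 :: "ell2 \<Rightarrow> ell2" where "sgn_ell2 x = x /\<^sub>R norm x"
definition dist_ell2 :: "ell2 \<Rightarrow> ell2 \<Rightarrow> real" where "dist_ell2 x y = norm (x - y)"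
definition uniformity_ell2 :: "(ell2 \<times> ell2) filter" where
  "uniformity_ell2 = (INF e\<in>{0 <..}. principal {(x, y). dist x y < e})"
definition open_ell2 :: "ell2 set \<Rightarrow> bool" where
  "open_ell2 U \<longleftrightarrow> (\<forall>x\<in>U. eventually (\<lambda>(x', y). x' = x \<longrightarrow> y \<in> U) uniformity)"

instance
proof
  fix x y z :: ell2 and r :: real
  show "inner x y = inner y x"
    unfolding inner_ell2_def by (subst cinner_commute) simp
  show "inner (x + y) z = inner x z + inner y z"
    by (simp add: inner_ell2_def cinner_add_left)
  show "inner (r *\<^sub>R x) y = r * inner x y"
    by (simp add: inner_ell2_def scaleR_scaleC_ell2 cinner_scaleC_left)
  show "0 \<le> inner x x"
    by (simp add: inner_ell2_def cinner_self suminf_nonneg summable_coord_sq)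
  show "inner x x = 0 \<longleftrightarrow> x = 0"
    by (auto simp: inner_ell2_def cinner_self suminf_eq_zero_iff summable_coord_sq intro: ell2_eqI)
qed (simp_all add: sgn_ell2_def dist_ell2_def uniformity_ell2_def open_ell2_def norm_ell2_def)

end

lemma norm_ell2_sq: "(norm x)\<^sup>2 = (\<Sum>n. (cmod (coord x n))\<^sup>2)"
  by (simp add: power2_norm_eq_inner inner_ell2_def cinner_self)

lemma cinner_self_norm: "cinner x x = of_real ((norm x)\<^sup>2)"
  by (simp add: cinner_self norm_ell2_sq)

lemma norm_scaleC_ell2: "norm (c *\<^sub>C x) = cmod c * norm (x :: ell2)"
proof -
  have "(norm (c *\<^sub>C x))\<^sup>2 = (cmod c * norm x)\<^sup>2"
    by (simp add: norm_ell2_sq norm_mult power_mult_distrib suminf_mult summable_coord_sq)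
  then show ?thesis by (simp add: power2_eq_iff_nonneg)
qed

lift_definition ket :: "nat \<Rightarrow> ell2" is "\<lambda>k n. if n = k then 1 else 0"
  by (rule summable_finite[of "{_}"]) auto

lemma coord_ket [simp]: "coord (ket k) n = (if n = k then 1 else 0)"
  by transfer simp


section \<open>The algebra \<open>B(\<H>)\<close>\<close>

text \<open>The bounded complex-linear operators; \<^const>\<open>bounded_linear\<close> is only real-linear.\<close>

typedef bop = "{f :: ell2 \<Rightarrow> ell2. bounded_linear f \<and> (\<forall>c x. f (c *\<^sub>C x) = c *\<^sub>C f x)}"
  morphisms app Abs_bop
  by (rule exI[of _ "\<lambda>_. 0"]) (auto intro: ell2_eqI)

setup_lifting type_definition_bop

lemma bop_eqI: "(\<And>v. app x v = app y v) \<Longrightarrow> x = y"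
  using app_inject by blast

lemma app_bounded_linear: "bounded_linear (app x)"
  using app[of x] by simp

lemma app_scaleC: "app x (c *\<^sub>C v) = c *\<^sub>C app x v"
  using app[of x] by simp

instantiation bop :: ring_1
begin

lift_definition zero_bop :: bop is "\<lambda>_. 0" by (auto intro: ell2_eqI)
lift_definition one_bop :: bop is "\<lambda>v. v" by (simp add: bounded_linear_ident)
lift_definition plus_bop :: "bop \<Rightarrow> bop \<Rightarrow> bop" is "\<lambda>f g v. f v + g v"
  by (auto intro!: bounded_linear_add ell2_eqI simp: algebra_simps)
lift_definition uminus_bop :: "bop \<Rightarrow> bop" is "\<lambda>f v. - f v"
  by (auto intro!: bounded_linear_minus ell2_eqI)
lift_definition minus_bop :: "bop \<Rightarrow> bop \<Rightarrow> bop" is "\<lambda>f g v. f v - g v"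
  by (auto intro!: bounded_linear_sub ell2_eqI simp: algebra_simps)
lift_definition times_bop :: "bop \<Rightarrow> bop \<Rightarrow> bop" is "\<lambda>f g v. f (g v)"
  by (auto intro: bounded_linear_compose)

instance
proof
  have "app (0 :: bop) (ket 0) \<noteq> app 1 (ket 0)"
  proof
    assume "app (0 :: bop) (ket 0) = app 1 (ket 0)"
    then have "coord 0 0 = coord (ket 0) 0" by (simp add: zero_bop.rep_eq one_bop.rep_eq)
    then show False by simp
  qed
  then show "(0 :: bop) \<noteq> 1" by auto
qed (transfer; auto simp: fun_eq_iff linear_simps)+

end

lemma norm_bounded_scaleC: "bounded_linear (\<lambda>v :: ell2. c *\<^sub>C v)"
  by (rule bounded_linear_intro[where K = "cmod c"])
    (auto intro: ell2_eqI simp: algebra_simps norm_scaleC_ell2)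

instantiation bop :: scaleC
begin
lift_definition scaleC_bop :: "complex \<Rightarrow> bop \<Rightarrow> bop" is "\<lambda>c f v. c *\<^sub>C f v"
  by (auto intro: bounded_linear_compose[OF norm_bounded_scaleC] ell2_eqI)
instance ..
end

lemma app_simps [simp]:
  "app 0 v = 0" "app 1 v = v" "app (x + y) v = app x v + app y v"
  "app (- x) v = - app x v" "app (x - y) v = app x v - app y v"
  "app (x * y) v = app x (app y v)" "app (c *\<^sub>C x) v = c *\<^sub>C app x v"
  by (transfer; simp)+

definition adj :: "bop \<Rightarrow> bop" where
  "adj x = (THE y. \<forall>v w. cinner (app x v) w = cinner v (app y w))"

lemma cinner_ket_left: "cinner (ket n) w = cnj (coord w n)"
proof -
  have "cinner (ket n) w = (\<Sum>k. if k = n then cnj (coord w k) else 0)"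
    unfolding cinner_def by (rule suminf_cong) simp
  also have "\<dots> = cnj (coord w n)"
    by (subst suminf_finite[of "{n}"]) auto
  finally show ?thesis .
qed

lemma cinner_ext: "(\<And>v. cinner v w = cinner v w') \<Longrightarrow> w = w'"
  by (rule ell2_eqI) (metis cinner_ket_left complex_cnj_cancel_iff)

lemma adj_eqI:
  assumes "\<And>v w. cinner (app x v) w = cinner v (app y w)"
  shows "adj x = y"
  unfolding adj_def
proof (rule the_equality)
  fix z assume "\<forall>v w. cinner (app x v) w = cinner v (app z w)"
  then show "z = y"
    by (intro bop_eqI cinner_ext) (metis assms)
qed (use assms in blast)

lemma cinner_bounded: "cmod (cinner x y) \<le> norm x * norm y"
proof (cases "cinner x y = 0")
  case False
  define c where "c = cnj (cinner x y) / of_real (cmod (cinner x y))"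
  have c: "cmod c = 1" using False by (simp add: c_def norm_divide)
  have "c * cinner x y = of_real (cmod (cinner x y))"
    using False
    by (simp add: c_def mult.commute[of "cnj _"] complex_norm_square[symmetric] power2_eq_square)
  then have "cmod (cinner x y) = inner (c *\<^sub>C x) y"
    by (simp add: inner_ell2_def cinner_scaleC_left)
  also have "\<dots> \<le> norm (c *\<^sub>C x) * norm y" by (rule norm_cauchy_schwarz)
  finally show ?thesis using c by (simp add: norm_scaleC_ell2)
qed simp

lemma sum_cinner_ket:
  "cinner (\<Sum>n<N. c n *\<^sub>C ket n) w = (\<Sum>n<N. c n * cnj (coord w n))"
proof (induction N)
  case 0
  show ?case by (simp add: cinner_def)
qed (simp add: cinner_add_left cinner_scaleC_left cinner_ket_left)

lemma coord_sum_ket: "coord (\<Sum>n<N. c n *\<^sub>C ket n) k = (if k < N then c k else 0)"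
  by (induction N) (auto simp: less_Suc_eq)

lemma adj_exists: "\<exists>y. \<forall>v w. cinner (app x v) w = cinner v (app y w)"
proof -
  obtain K where K0: "K > 0" and K: "\<And>v. norm (app x v) \<le> norm v * K"
    using bounded_linear.pos_bounded[OF app_bounded_linear] by blast
  define g where "g w n = cnj (cinner (app x (ket n)) w)" for w n
  have fin: "(\<Sum>n<N. (cmod (g w n))\<^sup>2) \<le> (K * norm w)\<^sup>2" for w N
  proof -
    define S where "S = (\<Sum>n<N. (cmod (g w n))\<^sup>2)"
    define v where "v = (\<Sum>n<N. g w n *\<^sub>C ket n)"
    have S0: "S \<ge> 0" by (simp add: S_def sum_nonneg)
    have cv: "coord v n = (if n < N then g w n else 0)" for n
      by (simp add: v_def coord_sum_ket)
    have nv: "(norm v)\<^sup>2 = S"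
    proof -
      have "(norm v)\<^sup>2 = (\<Sum>n<N. (cmod (coord v n))\<^sup>2)"
        unfolding norm_ell2_sq by (rule suminf_finite) (auto simp: cv)
      then show ?thesis by (simp add: S_def cv)
    qed
    have "app x v = (\<Sum>n<N. g w n *\<^sub>C app x (ket n))"
      unfolding v_def
      by (simp add: linear_sum[OF bounded_linear.linear[OF app_bounded_linear]] app_scaleC)
    then have "cinner (app x v) w = (\<Sum>n<N. g w n * cnj (g w n))"
    proof -
      have "cinner (\<Sum>n<N. g w n *\<^sub>C app x (ket n)) w = (\<Sum>n<N. g w n * cnj (g w n))" for N
        by (induction N) (simp_all add: cinner_add_left cinner_scaleC_left g_def cinner_def[of 0])
      then show ?thesis using \<open>app x v = _\<close> by simp
    qed
    also have "\<dots> = of_real S"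
      by (simp add: S_def complex_norm_square[symmetric] del: of_real_power)
    finally have "S = cmod (cinner (app x v) w)" using S0 by simp
    also have "\<dots> \<le> norm (app x v) * norm w" by (rule cinner_bounded)
    also have "\<dots> \<le> norm v * K * norm w" by (intro mult_right_mono K) simp
    finally have "norm v * norm v \<le> norm v * (K * norm w)"
      using nv by (simp add: power2_eq_square mult.assoc)
    then have "norm v \<le> K * norm w"
      using K0 by (cases "norm v = 0") (auto simp: mult_le_cancel_left)
    then have "(norm v)\<^sup>2 \<le> (K * norm w)\<^sup>2" by (intro power_mono) auto
    then show ?thesis using nv by (simp add: S_def)
  qed
  have sq: "summable (\<lambda>n. (cmod (g w n))\<^sup>2)" for w
    by (rule summableI_nonneg_bounded[OF _ fin]) simp
  define h where "h w = Abs_ell2 (g w)" for w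
  have ch: "coord (h w) n = g w n" for w n
    using sq by (simp add: h_def Abs_ell2_inverse)
  have hb: "norm (h w) \<le> norm w * K" for w
  proof -
    have "(norm (h w))\<^sup>2 \<le> (K * norm w)\<^sup>2"
      unfolding norm_ell2_sq ch by (rule suminf_le_const[OF sq fin])
    then have "norm (h w) \<le> K * norm w"
      using K0 by (meson less_eq_real_def mult_nonneg_nonneg norm_ge_zero power2_le_imp_le)
    then show ?thesis by (simp add: mult.commute)
  qed
  have "bounded_linear h"
    by (rule bounded_linear_intro[where K = K, OF _ _ hb])
      (auto intro!: ell2_eqI simp: ch g_def cinner_add_right scaleR_scaleC_ell2 cinner_scaleC_right)
  moreover have "h (c *\<^sub>C w) = c *\<^sub>C h w" for c w
    by (auto intro!: ell2_eqI simp: ch g_def cinner_scaleC_right)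
  ultimately have ah: "app (Abs_bop h) = h" by (simp add: Abs_bop_inverse)
  have "cinner (app x v) w = cinner v (h w)" for v w
  proof -
    define vN where "vN N = (\<Sum>n<N. coord v n *\<^sub>C ket n)" for N
    have cvN: "coord (vN N) n = (if n < N then coord v n else 0)" for N n
      by (simp add: vN_def coord_sum_ket)
    have nvN: "(norm (v - vN N))\<^sup>2 = (\<Sum>n. (cmod (coord v (n + N)))\<^sup>2)" for N
    proof -
      have "(norm (v - vN N))\<^sup>2
          = (\<Sum>n. (cmod (coord (v - vN N) (n + N)))\<^sup>2) + (\<Sum>n<N. (cmod (coord (v - vN N) n))\<^sup>2)"
        unfolding norm_ell2_sq by (rule suminf_split_initial_segment[OF summable_coord_sq])
      then show ?thesis by (simp add: cvN)
    qed
    have "(\<lambda>N. (norm (v - vN N))\<^sup>2) \<longlonglongrightarrow> 0"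
      unfolding nvN using suminf_exist_split2[OF summable_coord_sq] by (simp add: add.commute)
    then have "(\<lambda>N. norm (v - vN N)) \<longlonglongrightarrow> 0"
      using tendsto_real_sqrt[of "\<lambda>N. (norm (v - vN N))\<^sup>2" 0] by simp
    then have lim: "(\<lambda>N. norm (v - vN N) * (2 * K * norm w)) \<longlonglongrightarrow> 0"
      by (rule tendsto_mult_left_zero)
    have eq: "cinner (app x (vN N)) w = cinner (vN N) (h w)" for N
    proof -
      have "app x (vN N) = (\<Sum>n<N. coord v n *\<^sub>C app x (ket n))"
        unfolding vN_def
        by (simp add: linear_sum[OF bounded_linear.linear[OF app_bounded_linear]] app_scaleC)
      moreover have "cinner (\<Sum>n<N. coord v n *\<^sub>C app x (ket n)) w
          = (\<Sum>n<N. coord v n * cnj (g w n))"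
        by (induction N) (simp_all add: cinner_add_left cinner_scaleC_left g_def cinner_def[of 0])
      ultimately show ?thesis by (simp add: vN_def sum_cinner_ket ch)
    qed
    have "cmod (cinner (app x v) w - cinner v (h w)) \<le> norm (v - vN N) * (2 * K * norm w)" for N
    proof -
      have "app x v = app x (v - vN N) + app x (vN N)"
        by (simp add: linear_diff[OF bounded_linear.linear[OF app_bounded_linear]])
      then have 1: "cinner (app x v) w = cinner (app x (v - vN N)) w + cinner (app x (vN N)) w"
        by (simp only: cinner_add_left)
      have 2: "cinner v (h w) = cinner (v - vN N) (h w) + cinner (vN N) (h w)"
        by (simp flip: cinner_add_left)
      have "cmod (cinner (app x v) w - cinner v (h w))
          = cmod (cinner (app x (v - vN N)) w - cinner (v - vN N) (h w))"
        by (simp add: 1 2 eq)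
      also have "\<dots> \<le> cmod (cinner (app x (v - vN N)) w) + cmod (cinner (v - vN N) (h w))"
        by (rule norm_triangle_ineq4)
      also have "\<dots> \<le> norm (v - vN N) * K * norm w + norm (v - vN N) * (norm w * K)"
        by (intro add_mono order_trans[OF cinner_bounded] mult_right_mono mult_left_mono K hb) auto
      finally show ?thesis by (simp add: algebra_simps)
    qed
    then have "cmod (cinner (app x v) w - cinner v (h w)) \<le> 0"
      by (intro LIMSEQ_le_const[OF lim]) auto
    then show ?thesis by simp
  qed
  then show ?thesis by (metis ah)
qed

lemma cinner_adj: "cinner (app x v) w = cinner v (app (adj x) w)"
  using adj_exists[of x] adj_eqI[of x] by metis

lift_definition diag_vec :: "(nat \<Rightarrow> complex) \<Rightarrow> ell2 \<Rightarrow> ell2"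
  is "\<lambda>d f n. if Bseq d then d n * f n else 0"
  subgoal for d f by (cases "Bseq d") (simp_all add: summable_sq_mult_bounded)
  done

lemma coord_diag_vec: "coord (diag_vec d v) n = (if Bseq d then d n * coord v n else 0)"
  by transfer simp

text \<open>The diagonal operator of a bounded sequence; for an unbounded one the value is the
  junk value 0.\<close>

lift_definition diag_op :: "(nat \<Rightarrow> complex) \<Rightarrow> bop" is diag_vec
proof (intro conjI allI)
  fix d :: "nat \<Rightarrow> complex"
  obtain K where "Bseq d \<Longrightarrow> \<forall>n. cmod (d n) \<le> K"
    by (cases "Bseq d") (auto simp: Bseq_def)
  then have K: "Bseq d \<Longrightarrow> cmod (d n) \<le> \<bar>K\<bar>" for n
    using abs_ge_self order_trans by blast
  show "bounded_linear (diag_vec d)"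
  proof (rule bounded_linear_intro[where K = "\<bar>K\<bar>"])
    fix v
    have "(norm (diag_vec d v))\<^sup>2 \<le> (\<Sum>n. K\<^sup>2 * (cmod (coord v n))\<^sup>2)"
      unfolding norm_ell2_sq
    proof (rule suminf_le)
      fix n
      show "(cmod (coord (diag_vec d v) n))\<^sup>2 \<le> K\<^sup>2 * (cmod (coord v n))\<^sup>2"
        using K[of n] power_mono[of "cmod (d n)" "\<bar>K\<bar>" 2]
        by (auto simp: coord_diag_vec norm_mult power_mult_distrib intro!: mult_right_mono)
    qed (intro summable_coord_sq summable_mult)+
    also have "\<dots> = (norm v * \<bar>K\<bar>)\<^sup>2"
      by (simp add: suminf_mult summable_coord_sq norm_ell2_sq power_mult_distrib mult.commute)
    finally show "norm (diag_vec d v) \<le> norm v * \<bar>K\<bar>"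
      by (rule power2_le_imp_le) simp
  qed (auto intro!: ell2_eqI simp: coord_diag_vec algebra_simps)
  show "diag_vec d (c *\<^sub>C v) = c *\<^sub>C diag_vec d v" for c v
    by (auto intro!: ell2_eqI simp: coord_diag_vec)
qed

lemma coord_diag_op:
  "Bseq d \<Longrightarrow> coord (app (diag_op d) v) n = d n * coord v n"
  by (simp add: diag_op.rep_eq coord_diag_vec)

lemma diag_op_ket: "Bseq d \<Longrightarrow> app (diag_op d) (ket n) = d n *\<^sub>C ket n"
  by (rule ell2_eqI) (simp add: coord_diag_op)

lift_definition shift_vec :: "ell2 \<Rightarrow> ell2" is "\<lambda>f n. case n of 0 \<Rightarrow> 0 | Suc m \<Rightarrow> f m"
  by (subst summable_Suc_iff[symmetric]) simp

lemma coord_shift_vec: "coord (shift_vec v) n = (case n of 0 \<Rightarrow> 0 | Suc m \<Rightarrow> coord v m)"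
  by transfer simp

lemma norm_shift_vec: "norm (shift_vec v) = norm v"
proof -
  have "(norm (shift_vec v))\<^sup>2 = (norm v)\<^sup>2"
    unfolding norm_ell2_sq
    using suminf_split_head[OF summable_coord_sq[of "shift_vec v"]] by (simp add: coord_shift_vec)
  then show ?thesis by (simp add: power2_eq_iff_nonneg)
qed

lift_definition shift_op :: bop is shift_vec
  by (auto intro!: bounded_linear_intro[where K = 1] ell2_eqI
      simp: coord_shift_vec norm_shift_vec split: nat.split)

lemma shift_op_ket: "app shift_op (ket n) = ket (Suc n)"
  by (rule ell2_eqI) (simp add: shift_op.rep_eq coord_shift_vec split: nat.split)


lemma adj_shift_op: "coord (app (adj shift_op) v) n = coord v (Suc n)"
proof -
  have "cnj (coord (app (adj shift_op) v) n) = cnj (coord v (Suc n))"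
    by (simp add: cinner_ket_left[symmetric] cinner_adj[symmetric] shift_op_ket)
  then show ?thesis by simp
qed

lemma adj_diag_op:
  assumes "Bseq d"
  shows "adj (diag_op d) = diag_op (\<lambda>n. cnj (d n))"
proof (rule adj_eqI)
  have "Bseq (\<lambda>n. cnj (d n))" using assms by (simp add: Bseq_def)
  then show "cinner (app (diag_op d) v) w = cinner v (app (diag_op (\<lambda>n. cnj (d n))) w)" for v w
    unfolding cinner_def by (intro suminf_cong) (simp add: coord_diag_op assms)
qed

lemma adj_adj: "adj (adj x) = x"
  by (rule adj_eqI) (metis cinner_adj cinner_commute)

lemma adj_times: "adj (x * y) = adj y * adj x"
  by (rule adj_eqI) (simp add: cinner_adj)

lemma adj_scaleC: "adj (c *\<^sub>C x) = cnj c *\<^sub>C adj x"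
  by (rule adj_eqI) (simp add: cinner_adj cinner_scaleC_left cinner_scaleC_right)


section \<open>Operators on \<open>\<H> \<otimes> \<complex>\<^sup>2\<close> and the transition operator\<close>

text \<open>\<open>B(\<H> \<otimes> \<complex>\<^sup>2)\<close> is the type \<^typ>\<open>bop^2^2\<close>, with the library's matrix product.\<close>

definition mat_adj :: "bop^2^2 \<Rightarrow> bop^2^2" where
  "mat_adj M = (\<chi> i j. adj (M $ j $ i))"

definition tensor :: "bop \<Rightarrow> complex^2^2 \<Rightarrow> bop^2^2" where
  "tensor x y = (\<chi> i j. (y $ i $ j) *\<^sub>C x)"

definition mat_unit :: "2 \<Rightarrow> 2 \<Rightarrow> complex^2^2" where
  "mat_unit k l = (\<chi> i j. if i = k \<and> j = l then 1 else 0)"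

text \<open>Every \<open>M\<close> is \<open>\<Sum>i j. M\<^sub>i\<^sub>j \<otimes> E\<^sub>i\<^sub>j\<close>, so this is the linear extension of
  \<open>x \<otimes> y \<mapsto> \<psi>(y) x\<close>; see \<open>P_map_tensor\<close> and \<open>P_map_unique\<close>.\<close>

definition P_map :: "(complex^2^2 \<Rightarrow> complex) \<Rightarrow> bop^2^2 \<Rightarrow> bop" where
  "P_map \<psi> M = (\<Sum>i\<in>UNIV. \<Sum>j\<in>UNIV. \<psi> (mat_unit i j) *\<^sub>C (M $ i $ j))"

lemma P_map_add: "P_map \<psi> (M + N) = P_map \<psi> M + P_map \<psi> N"
  by (rule bop_eqI, rule ell2_eqI) (simp add: P_map_def sum_2 algebra_simps)

lemma P_map_tensor:
  assumes "\<And>y z. \<psi> (y + z) = \<psi> y + \<psi> z" and "\<And>c y. \<psi> (\<chi> i j. c * y $ i $ j) = c * \<psi> y"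
  shows "P_map \<psi> (tensor x y) = \<psi> y *\<^sub>C x"
proof -
  have y: "y = (\<chi> i j. y$1$1 * mat_unit 1 1 $ i $ j) + (\<chi> i j. y$1$2 * mat_unit 1 2 $ i $ j)
      + ((\<chi> i j. y$2$1 * mat_unit 2 1 $ i $ j) + (\<chi> i j. y$2$2 * mat_unit 2 2 $ i $ j))"
    by (simp add: vec_eq_iff forall_2 mat_unit_def)
  have "\<psi> y = y$1$1 * \<psi> (mat_unit 1 1) + y$1$2 * \<psi> (mat_unit 1 2)
      + (y$2$1 * \<psi> (mat_unit 2 1) + y$2$2 * \<psi> (mat_unit 2 2))"
    by (subst y) (simp only: assms)
  then show ?thesis
    by (intro bop_eqI ell2_eqI) (simp add: P_map_def tensor_def sum_2 algebra_simps)
qed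

lemma P_map_unique:
  assumes "\<And>M N. P (M + N) = P M + P N" and "\<And>x y. P (tensor x y) = \<psi> y *\<^sub>C x"
  shows "P = P_map \<psi>"
proof
  fix M :: "bop^2^2"
  have one: "1 *\<^sub>C (x :: bop) = x" and zero: "0 *\<^sub>C x = 0" for x
    by (rule bop_eqI, rule ell2_eqI, simp)+
  have M: "M = (tensor (M$1$1) (mat_unit 1 1) + tensor (M$1$2) (mat_unit 1 2))
      + (tensor (M$2$1) (mat_unit 2 1) + tensor (M$2$2) (mat_unit 2 2))"
    by (simp add: vec_eq_iff forall_2 mat_unit_def tensor_def one zero)
  have "P M = (\<psi> (mat_unit 1 1) *\<^sub>C (M$1$1) + \<psi> (mat_unit 1 2) *\<^sub>C (M$1$2))
      + (\<psi> (mat_unit 2 1) *\<^sub>C (M$2$1) + \<psi> (mat_unit 2 2) *\<^sub>C (M$2$2))"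
    by (subst M) (simp only: assms)
  then show "P M = P_map \<psi> M" by (simp add: P_map_def sum_2)
qed

definition u_mat :: "(nat \<Rightarrow> real) \<Rightarrow> (nat \<Rightarrow> real) \<Rightarrow> bop^2^2" where
  "u_mat \<alpha>s \<beta>s =
    (let a = diag_op (\<lambda>n. of_real (\<alpha>s n)); b = diag_op (\<lambda>n. of_real (\<beta>s n)); s = shift_op
     in vector [vector [adj s * a * s, \<i> *\<^sub>C (adj s * b)],
                vector [\<i> *\<^sub>C (b * s), a]])"

lemma u_mat_unitary:
  assumes "\<alpha>s 0 = 1" "\<beta>s 0 = 0" and sq: "\<And>n. (\<alpha>s n)\<^sup>2 + (\<beta>s n)\<^sup>2 = 1"
  shows "mat_adj (u_mat \<alpha>s \<beta>s) ** u_mat \<alpha>s \<beta>s = mat 1"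
    and "u_mat \<alpha>s \<beta>s ** mat_adj (u_mat \<alpha>s \<beta>s) = mat 1"
proof -
  have le: "\<bar>\<alpha>s n\<bar> \<le> 1" "\<bar>\<beta>s n\<bar> \<le> 1" for n
    using sq[of n] by (simp_all add: abs_square_le_1[symmetric]) (smt (verit) zero_le_power2)+
  have B: "Bseq (\<lambda>n. complex_of_real (\<alpha>s n))" "Bseq (\<lambda>n. complex_of_real (\<beta>s n))"
    using le by (auto intro!: BseqI'[where K = 1])
  have sq': "complex_of_real (\<alpha>s n) * (complex_of_real (\<alpha>s n) * z)
      + complex_of_real (\<beta>s n) * (complex_of_real (\<beta>s n) * z) = z" for n z
  proof -
    have "complex_of_real (\<alpha>s n) * (complex_of_real (\<alpha>s n) * z)
      + complex_of_real (\<beta>s n) * (complex_of_real (\<beta>s n) * z)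
      = complex_of_real ((\<alpha>s n)\<^sup>2 + (\<beta>s n)\<^sup>2) * z"
      by (simp add: power2_eq_square algebra_simps)
    then show ?thesis by (simp add: sq)
  qed
  have ii: "\<i> * (x * (\<i> * y)) = - (x * y)" for x y
    by (simp add: mult.left_commute[of x \<i>])
  note defs = mat_adj_def u_mat_def Let_def matrix_matrix_mult_def mat_def vec_eq_iff forall_2 sum_2
    vector_2 adj_times adj_scaleC adj_adj adj_diag_op B
  note coords = coord_diag_op B adj_shift_op shift_op.rep_eq coord_shift_vec assms(1,2) sq' ii
    trans[OF add.commute sq']
  show "mat_adj (u_mat \<alpha>s \<beta>s) ** u_mat \<alpha>s \<beta>s = mat 1"
    unfolding defs
    by (intro conjI bop_eqI ell2_eqI; simp add: defs coords split: nat.split)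
  show "u_mat \<alpha>s \<beta>s ** mat_adj (u_mat \<alpha>s \<beta>s) = mat 1"
    unfolding defs
    by (intro conjI bop_eqI ell2_eqI; simp add: defs coords split: nat.split)
qed

definition transition_op :: "bop^2^2 \<Rightarrow> (complex^2^2 \<Rightarrow> complex) \<Rightarrow> bop \<Rightarrow> bop" where
  "transition_op u \<psi> x = P_map \<psi> (mat_adj u ** tensor x (mat 1) ** u)"

definition rho :: "real \<Rightarrow> complex \<Rightarrow> complex^2^2" where
  "rho lam \<zeta> = vector [vector [of_real lam, cnj \<zeta> * of_real (sqrt (lam * (1 - lam)))],
                      vector [\<zeta> * of_real (sqrt (lam * (1 - lam))), of_real (1 - lam)]]"

definition M2_state :: "real \<Rightarrow> complex \<Rightarrow> complex^2^2 \<Rightarrow> complex" where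
  "M2_state lam \<zeta> y = trace (rho lam \<zeta> ** y)"


section \<open>Pure invariant normal states\<close>

definition vector_state :: "ell2 \<Rightarrow> bop \<Rightarrow> complex" where
  "vector_state \<xi> x = cinner (app x \<xi>) \<xi>"

text \<open>With \<open>\<psi> = Tr(\<rho> \<cdot>)\<close>, \<open>\<rho>\<^sub>1\<^sub>2 = cnj \<zeta> * sqrt (\<lambda> (1 - \<lambda>))\<close> and \<open>\<bar>\<zeta>\<bar> = 1\<close>, \<open>\<psi>\<close> is the vector state of
  \<open>v = (sqrt \<lambda>, \<zeta> * sqrt (1 - \<lambda>))\<close>, and the vector state of \<open>\<xi>\<close> is invariant iff \<open>u (\<xi> \<otimes> v) = \<xi> \<otimes> w\<close>
  for some \<open>w\<close>. The second row of \<open>u\<close> then gives \<open>\<xi>\<^sub>n = q \<xi>\<^sub>n\<^sub>-\<^sub>1\<close> with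
  \<open>q = \<i> * cnj \<zeta> * \<beta> / (1 - \<alpha>) * sqrt (\<lambda> / (1 - \<lambda>))\<close>. The published formula,
  \<open>- \<i> * \<zeta> * \<beta> / (1 - \<alpha>) * sqrt (\<lambda> / (1 - \<lambda>))\<close>, is the complex conjugate of this and fails for these
  conventions unless \<open>\<zeta> = \<plusminus>\<i>\<close>.\<close>

definition pure_normal_state :: "(bop \<Rightarrow> complex) \<Rightarrow> bool" where
  "pure_normal_state \<phi> \<longleftrightarrow> (\<exists>\<xi>. norm \<xi> = 1 \<and> \<phi> = vector_state \<xi>)"

definition invariant_state :: "(bop \<Rightarrow> bop) \<Rightarrow> (bop \<Rightarrow> complex) \<Rightarrow> bool" where
  "invariant_state T \<phi> \<longleftrightarrow> \<phi> \<circ> T = \<phi>"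

end

theory Submission
  imports Defs
begin

text \<open>
  The state \<open>\<psi>\<close> is the vector state of the unit vector \<open>v = (sqrt \<lambda>, \<zeta> sqrt (1 - \<lambda>))\<close>, so the
  transition operator has the Kraus form \<open>T x = W\<^sub>1\<^sup>* x W\<^sub>1 + W\<^sub>2\<^sup>* x W\<^sub>2\<close>, where \<open>W\<^sub>k\<close> is the \<open>k\<close>-th
  component of \<open>\<eta> \<mapsto> u (\<eta> \<otimes> v)\<close>. Composing the vector state of \<open>\<xi>\<close> with \<open>T\<close> gives the sum of the
  vector functionals of \<open>W\<^sub>1 \<xi>\<close> and \<open>W\<^sub>2 \<xi>\<close>. A vector state is extremal: evaluation at the projection
  onto the orthogonal complement of \<open>\<xi>\<close> shows that such a sum can be the state of \<open>\<xi>\<close> only if both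
  vectors are multiples of \<open>\<xi>\<close>. Hence invariance means that \<open>\<xi>\<close> is a common eigenvector,
  \<open>W\<^sub>k \<xi> = w\<^sub>k \<xi>\<close>, with \<open>\<bar>w\<^sub>1\<bar>\<^sup>2 + \<bar>w\<^sub>2\<bar>\<^sup>2 = 1\<close> (\<open>invariant_vector_state_iff\<close>).

  The equation for \<open>W\<^sub>1\<close> determines each coordinate of \<open>\<xi>\<close> from the one before, so \<open>\<xi>\<^sub>0 \<noteq> 0\<close>. Since
  \<open>\<alpha>\<^sub>0 = 1\<close> and \<open>\<beta>\<^sub>0 = 0\<close>, the coordinate \<open>0\<close> of the equation for \<open>W\<^sub>2\<close> then fixes the eigenvalue
  \<open>w\<^sub>2 = v\<^sub>2\<close>, and its other coordinates become the geometric recursion \<open>\<xi>\<^sub>n\<^sub>+\<^sub>1 = q \<xi>\<^sub>n\<close>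
  (\<open>common_eigenvector_geometric\<close>). This determines \<open>\<xi>\<close> up to a phase, and square summability
  forces \<open>\<bar>q\<bar> < 1\<close>. Because \<open>\<beta>\<^sup>2 = (1 + \<alpha>) (1 - \<alpha>)\<close>, this is the condition \<open>\<lambda> < (1 - \<alpha>) / 2\<close>
  (\<open>norm_ratio_less_one_iff\<close>). Conversely, if \<open>\<bar>q\<bar> < 1\<close>, the normalised geometric vector does
  satisfy both equations, with \<open>w\<^sub>1 = - v\<^sub>1\<close> and \<open>w\<^sub>2 = v\<^sub>2\<close>, again by \<open>\<beta>\<^sup>2 = (1 + \<alpha>) (1 - \<alpha>)\<close>.
\<close>

section \<open>Extremality of vector states\<close>

text \<open>For a unit vector \<open>\<xi>\<close> this is the orthogonal projection onto the line spanned by \<open>\<xi>\<close>.\<close>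

lift_definition rank_one :: "ell2 \<Rightarrow> bop" is "\<lambda>\<xi> v. cinner v \<xi> *\<^sub>C \<xi>"
proof (intro conjI allI)
  fix \<xi> :: ell2
  show "bounded_linear (\<lambda>v. cinner v \<xi> *\<^sub>C \<xi>)"
  proof (rule bounded_linear_intro[where K = "norm \<xi> * norm \<xi>"])
    show "norm (cinner v \<xi> *\<^sub>C \<xi>) \<le> norm v * (norm \<xi> * norm \<xi>)" for v
      using mult_right_mono[OF cinner_bounded norm_ge_zero, of v \<xi> \<xi>]
      by (simp add: norm_scaleC_ell2 mult.assoc)
  qed (auto intro!: ell2_eqI
      simp: cinner_add_left cinner_scaleC_left scaleR_scaleC_ell2 algebra_simps)
qed (auto intro!: ell2_eqI simp: cinner_scaleC_left)

lemma cinner_diff_left: "cinner (x - y) z = cinner x z - cinner y z"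
  using cinner_add_left[of "x - y" y z] by simp

lemma cinner_diff_right: "cinner x (y - z) = cinner x y - cinner x z"
  using cinner_add_right[of x "y - z" z] by simp

lemma vector_state_scaleC: "vector_state (c *\<^sub>C \<xi>) x = (cmod c)\<^sup>2 * vector_state \<xi> x"
  by (simp add: vector_state_def app_scaleC cinner_scaleC_left cinner_scaleC_right
      complex_norm_square flip: of_real_power)

text \<open>Since \<open>1 - rank_one \<xi>\<close> is an orthogonal projection, its expectation at \<open>\<eta>\<close> is the squared length
  of its value there. In this way functionals on the operator algebra detect the distance of \<open>\<eta>\<close> to the
  line through \<open>\<xi>\<close>.\<close>

lemma norm_sq_diff_projection:
  assumes "norm \<xi> = 1"
  shows "(norm (\<eta> - cinner \<eta> \<xi> *\<^sub>C \<xi>))\<^sup>2 = Re (vector_state \<eta> (1 - rank_one \<xi>))"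
proof -
  have one: "cinner \<xi> \<xi> = 1" using assms by (simp add: cinner_self_norm)
  have "cinner (\<eta> - cinner \<eta> \<xi> *\<^sub>C \<xi>) (\<eta> - cinner \<eta> \<xi> *\<^sub>C \<xi>) = vector_state \<eta> (1 - rank_one \<xi>)"
    by (simp add: vector_state_def rank_one.rep_eq cinner_diff_left cinner_diff_right
        cinner_scaleC_left cinner_scaleC_right one)
  then show ?thesis by (metis cinner_self_norm Re_complex_of_real)
qed

text \<open>At the operator \<open>1 - rank_one \<xi>\<close> the state of \<open>\<xi>\<close> vanishes, while each summand is the squared
  distance of \<open>\<eta> k\<close> to the line through \<open>\<xi>\<close>. A sum of squares that vanishes has only zero terms.\<close>

lemma vector_state_sum_collinear:
  assumes "norm \<xi> = 1" and "finite I"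
    and sum: "\<And>x. (\<Sum>k\<in>I. vector_state (\<eta> k) x) = vector_state \<xi> x"
    and "k \<in> I"
  shows "\<eta> k = cinner (\<eta> k) \<xi> *\<^sub>C \<xi>"
proof -
  have one: "cinner \<xi> \<xi> = 1" using assms(1) by (simp add: cinner_self_norm)
  have "vector_state \<xi> (1 - rank_one \<xi>) = 0"
    by (simp add: vector_state_def rank_one.rep_eq cinner_diff_left cinner_scaleC_left one)
  then have "Re (\<Sum>k\<in>I. vector_state (\<eta> k) (1 - rank_one \<xi>)) = 0" by (simp add: sum)
  then have "(\<Sum>k\<in>I. (norm (\<eta> k - cinner (\<eta> k) \<xi> *\<^sub>C \<xi>))\<^sup>2) = 0"
    by (simp add: norm_sq_diff_projection[OF assms(1)])
  then have "(norm (\<eta> k - cinner (\<eta> k) \<xi> *\<^sub>C \<xi>))\<^sup>2 = 0"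
    using assms(2,4) by (subst (asm) sum_nonneg_eq_0_iff) auto
  then show ?thesis by simp
qed

section \<open>Invariance as a common eigenvector equation\<close>

text \<open>The operator \<open>\<eta> \<mapsto> (u (\<eta> \<otimes> v))\<^sub>k\<close>. When \<open>\<psi>\<close> is the vector functional of \<open>v\<close>, these are the Kraus
  operators of the transition operator.\<close>

definition kraus :: "bop^2^2 \<Rightarrow> complex^2 \<Rightarrow> 2 \<Rightarrow> bop" where
  "kraus u v k = (\<Sum>j\<in>UNIV. v $ j *\<^sub>C (u $ k $ j))"

text \<open>The rank-one form of \<open>\<psi>\<close> lets the double sum over its matrix entries factor, which gives
  \<open>T x = (\<Sum>k. W\<^sub>k\<^sup>* x W\<^sub>k)\<close> with \<open>W\<^sub>k = kraus u v k\<close>.\<close>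

lemma vector_state_transition_op:
  assumes "\<And>i j. \<psi> (mat_unit i j) = v $ j * cnj (v $ i)"
  shows "vector_state \<xi> (transition_op u \<psi> x) = (\<Sum>k\<in>UNIV. vector_state (app (kraus u v k) \<xi>) x)"
proof -
  have adj: "cinner (app (adj y) v) w = cinner v (app y w)" for y v w
    by (metis cinner_adj adj_adj)
  have scale: "0 *\<^sub>C (x :: bop) = 0" "1 *\<^sub>C x = x" for x
    by (rule bop_eqI, rule ell2_eqI, simp)+
  show ?thesis
    unfolding transition_op_def P_map_def
    by (simp add: assms kraus_def mat_adj_def tensor_def mat_def matrix_matrix_mult_def sum_2 scale
        vector_state_def app_scaleC linear_add[OF bounded_linear.linear[OF app_bounded_linear]]
        cinner_add_left cinner_add_right cinner_scaleC_left cinner_scaleC_right adj algebra_simps)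
qed

text \<open>Extremality gives the eigenvector equations; evaluation at the identity operator gives the
  normalisation of the eigenvalues. Conversely, a factor \<open>w\<close> in the vector multiplies its functional by
  \<open>\<bar>w\<bar>\<^sup>2\<close>, so only the total weight of the eigenvalues matters.\<close>

lemma invariant_vector_state_iff:
  assumes "norm \<xi> = 1" and "\<And>i j. \<psi> (mat_unit i j) = v $ j * cnj (v $ i)"
  shows "invariant_state (transition_op u \<psi>) (vector_state \<xi>) \<longleftrightarrow>
    (\<exists>w. (\<forall>k. app (kraus u v k) \<xi> = w k *\<^sub>C \<xi>) \<and> (\<Sum>k\<in>UNIV. (cmod (w k))\<^sup>2) = 1)"
    (is "?inv \<longleftrightarrow> ?eig")
proof -
  have inv: "?inv \<longleftrightarrow> (\<forall>x. (\<Sum>k\<in>UNIV. vector_state (app (kraus u v k) \<xi>) x) = vector_state \<xi> x)"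
    by (simp add: invariant_state_def fun_eq_iff vector_state_transition_op[OF assms(2)])
  have scaled: "(\<Sum>k\<in>UNIV. vector_state (w k *\<^sub>C \<xi>) x)
      = of_real (\<Sum>k\<in>UNIV. (cmod (w k))\<^sup>2) * vector_state \<xi> x" for w :: "2 \<Rightarrow> complex" and x
    by (simp add: vector_state_scaleC sum_distrib_right)
  show ?thesis
  proof
    assume ?inv
    define w where "w k = cinner (app (kraus u v k) \<xi>) \<xi>" for k
    have w: "app (kraus u v k) \<xi> = w k *\<^sub>C \<xi>" for k
      unfolding w_def using \<open>?inv\<close>
      by (intro vector_state_sum_collinear[OF assms(1) finite, where ?\<eta> = "\<lambda>k. app (kraus u v k) \<xi>"])
        (auto simp: inv)
    have "vector_state \<xi> 1 = 1" using assms(1) by (simp add: vector_state_def cinner_self_norm)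
    then have "complex_of_real (\<Sum>k\<in>UNIV. (cmod (w k))\<^sup>2) = 1"
      using \<open>?inv\<close> scaled[of w 1] unfolding inv w by simp
    then have "(\<Sum>k\<in>UNIV. (cmod (w k))\<^sup>2) = 1" by (simp only: of_real_eq_1_iff)
    with w show ?eig by blast
  next
    assume ?eig
    then obtain w where "\<And>k. app (kraus u v k) \<xi> = w k *\<^sub>C \<xi>" "(\<Sum>k\<in>UNIV. (cmod (w k))\<^sup>2) = 1"
      by blast
    then show ?inv unfolding inv using scaled[of w] by simp
  qed
qed

text \<open>For \<open>\<bar>\<zeta>\<bar> = 1\<close> the density matrix is \<open>v v\<^sup>*\<close>; the indices on the right are swapped because
  \<open>Tr (\<rho> E\<^sub>i\<^sub>j) = \<rho>\<^sub>j\<^sub>i\<close>.\<close>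

lemma M2_state_mat_unit:
  assumes "cmod \<zeta> = 1" "0 \<le> lam" "lam \<le> 1"
  defines "v \<equiv> vector [of_real (sqrt lam), \<zeta> * of_real (sqrt (1 - lam))] :: complex^2"
  shows "M2_state lam \<zeta> (mat_unit i j) = v $ j * cnj (v $ i)"
proof -
  have z: "\<zeta> * cnj \<zeta> = 1" using complex_norm_square[of \<zeta>] assms(1) by simp
  have r: "complex_of_real (sqrt r) * complex_of_real (sqrt r) = of_real r" if "0 \<le> r" for r
    using that by (simp flip: of_real_mult)
  have "\<zeta> * of_real (sqrt (1 - lam)) * (cnj \<zeta> * of_real (sqrt (1 - lam)))
      = (\<zeta> * cnj \<zeta>) * (of_real (sqrt (1 - lam)) * of_real (sqrt (1 - lam)))"
    by (simp only: mult_ac)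
  also have "\<dots> = of_real (1 - lam)" using r[of "1 - lam"] z assms(3) by simp
  finally show ?thesis
    using exhaust_2[of i] exhaust_2[of j] r[of lam] assms(2)
    by (auto simp: M2_state_def rho_def mat_unit_def v_def trace_def matrix_matrix_mult_def sum_2
        real_sqrt_mult)
qed

section \<open>Geometric vectors as solutions\<close>

lemma norm_ell2_geometric:
  assumes "\<And>n. coord \<xi> n = c * q ^ n" and "cmod q < 1"
  shows "(norm \<xi>)\<^sup>2 = (cmod c)\<^sup>2 / (1 - (cmod q)\<^sup>2)"
proof -
  have "(cmod q)\<^sup>2 < 1" using assms(2) by (simp add: power_less_one_iff)
  then have "(\<lambda>n. (cmod c)\<^sup>2 * ((cmod q)\<^sup>2) ^ n) sums ((cmod c)\<^sup>2 * (1 / (1 - (cmod q)\<^sup>2)))"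
    by (intro sums_mult geometric_sums) simp
  then show ?thesis
    unfolding norm_ell2_sq assms(1)
    by (simp add: sums_iff norm_mult norm_power power_mult_distrib mult.commute
        flip: power_mult)
qed

lemma geometric_square_summable_iff:
  assumes "c \<noteq> 0"
  shows "summable (\<lambda>n. (cmod (c * q ^ n))\<^sup>2) \<longleftrightarrow> cmod q < 1"
proof -
  have "(\<lambda>n. (cmod (c * q ^ n))\<^sup>2) = (\<lambda>n. (cmod c)\<^sup>2 * ((cmod q)\<^sup>2) ^ n)"
    by (simp add: norm_mult norm_power power_mult_distrib mult.commute flip: power_mult)
  then show ?thesis
    using assms by (simp add: summable_geometric_iff power_less_one_iff)
qed

lemma coord_kraus_u_mat:
  assumes "\<alpha>s 0 = 1" "\<beta>s 0 = 0" "\<And>n. n \<ge> 1 \<Longrightarrow> \<alpha>s n = \<alpha>" "\<And>n. n \<ge> 1 \<Longrightarrow> \<beta>s n = \<beta>"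
  shows "coord (app (kraus (u_mat \<alpha>s \<beta>s) v 1) \<xi>) n
      = v $ 1 * \<alpha> * coord \<xi> n + \<i> * v $ 2 * \<beta> * coord \<xi> (Suc n)"
    and "coord (app (kraus (u_mat \<alpha>s \<beta>s) v 2) \<xi>) 0 = v $ 2 * coord \<xi> 0"
    and "coord (app (kraus (u_mat \<alpha>s \<beta>s) v 2) \<xi>) (Suc n)
      = \<i> * v $ 1 * \<beta> * coord \<xi> n + v $ 2 * \<alpha> * coord \<xi> (Suc n)"
proof -
  have eq: "\<alpha>s n = (if n = 0 then 1 else \<alpha>)" "\<beta>s n = (if n = 0 then 0 else \<beta>)" for n
    using assms by auto
  have B: "Bseq (\<lambda>n. complex_of_real (\<alpha>s n))" "Bseq (\<lambda>n. complex_of_real (\<beta>s n))"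
    by (rule BseqI'[where K = "max 1 \<bar>\<alpha>\<bar>"], simp add: eq)
      (rule BseqI'[where K = "\<bar>\<beta>\<bar>"], simp add: eq)
  note defs = kraus_def sum_2 u_mat_def Let_def coord_diag_op B adj_shift_op shift_op.rep_eq
    coord_shift_vec
  show "coord (app (kraus (u_mat \<alpha>s \<beta>s) v 1) \<xi>) n
      = v $ 1 * \<alpha> * coord \<xi> n + \<i> * v $ 2 * \<beta> * coord \<xi> (Suc n)"
    and "coord (app (kraus (u_mat \<alpha>s \<beta>s) v 2) \<xi>) 0 = v $ 2 * coord \<xi> 0"
    and "coord (app (kraus (u_mat \<alpha>s \<beta>s) v 2) \<xi>) (Suc n)
      = \<i> * v $ 1 * \<beta> * coord \<xi> n + v $ 2 * \<alpha> * coord \<xi> (Suc n)"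
    by (simp_all add: defs assms)
qed

text \<open>If \<open>coord \<xi> 0\<close> were zero, the first equation, solved for \<open>coord \<xi> (Suc n)\<close>, would propagate this
  to all of \<open>\<xi>\<close>. So the second equation says \<open>w2 = v2\<close>, and with this eigenvalue the third is a
  first-order recursion with constant ratio.\<close>

lemma common_eigenvector_geometric:
  assumes "\<And>n. w1 * coord \<xi> n = v1 * a * coord \<xi> n + \<i> * v2 * b * coord \<xi> (Suc n)"
    and "w2 * coord \<xi> 0 = v2 * coord \<xi> 0"
    and "\<And>n. w2 * coord \<xi> (Suc n) = \<i> * v1 * b * coord \<xi> n + v2 * a * coord \<xi> (Suc n)"
    and "b \<noteq> 0" "v2 \<noteq> 0" "a \<noteq> 1" "\<xi> \<noteq> 0"
  shows "coord \<xi> 0 \<noteq> 0" and "coord \<xi> n = coord \<xi> 0 * (\<i> * v1 * b / (v2 * (1 - a))) ^ n"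
proof -
  show "coord \<xi> 0 \<noteq> 0"
  proof
    assume 0: "coord \<xi> 0 = 0"
    have "coord \<xi> n = 0" for n
    proof (induction n)
      case (Suc n)
      then show ?case using assms(1)[of n] assms(4,5) by simp
    qed (rule 0)
    then have "\<xi> = 0" by (intro ell2_eqI) simp
    with assms(7) show False by simp
  qed
  with assms(2) have w2: "w2 = v2" by simp
  show "coord \<xi> n = coord \<xi> 0 * (\<i> * v1 * b / (v2 * (1 - a))) ^ n"
  proof (induction n)
    case (Suc n)
    have "v2 * (1 - a) * coord \<xi> (Suc n) = \<i> * v1 * b * coord \<xi> n"
      using assms(3)[of n] unfolding w2 by (simp add: algebra_simps)
    then have "coord \<xi> (Suc n) = coord \<xi> n * (\<i> * v1 * b / (v2 * (1 - a)))"
      using assms(5,6) by (simp add: field_simps)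
    then show ?case using Suc by (simp add: mult_ac)
  qed simp
qed

text \<open>The absolute value is the modulus of the ratio \<open>q\<close>. By \<open>\<beta>\<^sup>2 = (1 + \<alpha>) (1 - \<alpha>)\<close> its square is
  \<open>(1 + \<alpha>) lam / ((1 - \<alpha>) (1 - lam))\<close>, so that the comparison with 1 is linear in \<open>lam\<close>.\<close>

lemma norm_ratio_less_one_iff:
  fixes \<alpha> \<beta> lam :: real
  assumes "\<alpha>\<^sup>2 + \<beta>\<^sup>2 = 1" "\<beta> \<noteq> 0" "0 < lam" "lam < 1"
  shows "\<bar>\<beta> / (1 - \<alpha>) * sqrt (lam / (1 - lam))\<bar> < 1 \<longleftrightarrow> lam < (1 - \<alpha>) / 2"
proof -
  have "0 < \<beta>\<^sup>2" using assms(2) by simp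
  with assms(1) have "\<alpha>\<^sup>2 < 1" by linarith
  then have a: "\<alpha> < 1" by (simp add: abs_square_less_1)
  have b: "\<beta>\<^sup>2 = (1 + \<alpha>) * (1 - \<alpha>)" using assms(1) by (simp add: algebra_simps power2_eq_square)
  have "(\<beta> / (1 - \<alpha>) * sqrt (lam / (1 - lam)))\<^sup>2 = \<beta>\<^sup>2 / (1 - \<alpha>)\<^sup>2 * (lam / (1 - lam))"
    using assms(3,4) by (simp add: power_mult_distrib power_divide)
  also have "\<dots> = (1 + \<alpha>) / (1 - \<alpha>) * (lam / (1 - lam))"
    using a unfolding b by (simp add: power2_eq_square)
  also have "\<dots> < 1 \<longleftrightarrow> (1 + \<alpha>) * lam < (1 - \<alpha>) * (1 - lam)"
    using a assms(4) by (simp add: divide_less_eq)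
  also have "\<dots> \<longleftrightarrow> lam < (1 - \<alpha>) / 2" by (simp add: algebra_simps)
  finally show ?thesis by (simp add: abs_square_less_1)
qed

theorem proposition5p1:
  fixes \<alpha> \<beta> lam :: real and \<zeta> q :: complex and \<alpha>s \<beta>s :: "nat \<Rightarrow> real"
    and \<psi> :: "complex^2^2 \<Rightarrow> complex" and T :: "bop \<Rightarrow> bop"
  assumes "\<alpha> \<in> {-1..1}" and "\<beta> \<in> {-1..1}" and "\<alpha>\<^sup>2 + \<beta>\<^sup>2 = 1" and "\<beta> \<noteq> 0"
    and "\<alpha>s 0 = 1" and "\<beta>s 0 = 0"
    and "\<And>n. n \<ge> 1 \<Longrightarrow> \<alpha>s n = \<alpha>" and "\<And>n. n \<ge> 1 \<Longrightarrow> \<beta>s n = \<beta>"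
    and "0 < lam" and "lam < 1" and "cmod \<zeta> = 1"
    and "\<psi> = M2_state lam \<zeta>"
    and "T = transition_op (u_mat \<alpha>s \<beta>s) \<psi>"
    and "q = cnj (- \<i> * \<zeta> * of_real (\<beta> / (1 - \<alpha>) * sqrt (lam / (1 - lam))))"
  shows "((\<exists>\<phi>. pure_normal_state \<phi> \<and> invariant_state T \<phi>) \<longleftrightarrow> lam < (1 - \<alpha>) / 2) \<and>
    (lam < (1 - \<alpha>) / 2 \<longrightarrow>
      (\<exists>\<xi>. (\<forall>n. coord \<xi> n = of_real (sqrt (1 - (cmod q)\<^sup>2)) * q ^ n) \<and>
           {\<phi>. pure_normal_state \<phi> \<and> invariant_state T \<phi>} = {vector_state \<xi>}))"
proof -
  define v :: "complex^2" where "v = vector [of_real (sqrt lam), \<zeta> * of_real (sqrt (1 - lam))]"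
  have v1: "v $ 1 = of_real (sqrt lam)" and v2: "v $ 2 = \<zeta> * of_real (sqrt (1 - lam))"
    by (simp_all add: v_def)
  have \<psi>: "\<psi> (mat_unit i j) = v $ j * cnj (v $ i)" for i j
    unfolding assms(12) v_def using assms(9-11) by (intro M2_state_mat_unit) auto
  let ?W = "kraus (u_mat \<alpha>s \<beta>s) v"
  have coord_W: "coord (app (?W 1) \<xi>) n = v $ 1 * \<alpha> * coord \<xi> n + \<i> * v $ 2 * \<beta> * coord \<xi> (Suc n)"
    "coord (app (?W 2) \<xi>) 0 = v $ 2 * coord \<xi> 0"
    "coord (app (?W 2) \<xi>) (Suc n) = \<i> * v $ 1 * \<beta> * coord \<xi> n + v $ 2 * \<alpha> * coord \<xi> (Suc n)"
    for \<xi> n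
    by (rule coord_kraus_u_mat; fact assms(5-8))+
  have inv_iff: "invariant_state T (vector_state \<xi>) \<longleftrightarrow>
      (\<exists>w. (\<forall>k. app (?W k) \<xi> = w k *\<^sub>C \<xi>) \<and> (\<Sum>k\<in>UNIV. (cmod (w k))\<^sup>2) = 1)"
    if "norm \<xi> = 1" for \<xi>
    unfolding assms(13) by (rule invariant_vector_state_iff[OF that \<psi>])
  have "\<zeta> \<noteq> 0" using assms(11) by auto
  then have v2_nz: "v $ 2 \<noteq> 0" using assms(10) by (simp add: v2)
  have \<alpha>_nz: "\<alpha> \<noteq> 1" using assms(3,4) by auto
  have cnj_\<zeta>: "\<zeta> * cnj \<zeta> = 1" using complex_norm_square[of \<zeta>] assms(11) by simp
  have q: "q = \<i> * v $ 1 * \<beta> / (v $ 2 * (1 - \<alpha>))"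
  proof -
    have "cnj \<zeta> = 1 / \<zeta>" using cnj_\<zeta> \<open>\<zeta> \<noteq> 0\<close> by (simp add: field_simps)
    then show ?thesis by (simp add: assms(14) v1 v2 real_sqrt_divide mult_ac)
  qed
  have q_less: "cmod q < 1 \<longleftrightarrow> lam < (1 - \<alpha>) / 2"
  proof -
    have "cmod q = \<bar>\<beta> / (1 - \<alpha>) * sqrt (lam / (1 - lam))\<bar>"
      unfolding assms(14) complex_mod_cnj norm_mult norm_of_real by (simp add: assms(11))
    then show ?thesis using norm_ratio_less_one_iff[OF assms(3,4,9,10)] by simp
  qed

  have necessary: "cmod q < 1 \<and> coord \<xi> n = coord \<xi> 0 * q ^ n"
    if n1: "norm \<xi> = 1" and inv: "invariant_state T (vector_state \<xi>)" for \<xi> n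
  proof -
    from inv inv_iff[OF n1] obtain w where w: "\<And>k. app (?W k) \<xi> = w k *\<^sub>C \<xi>" by blast
    have "\<xi> \<noteq> 0" using n1 by auto
    have wc: "w k * coord \<xi> n = coord (app (?W k) \<xi>) n" for k n by (simp add: w)
    note geo = common_eigenvector_geometric[where ?w1.0 = "w 1" and ?w2.0 = "w 2" and ?v1.0 = "v $ 1"
        and ?v2.0 = "v $ 2" and a = "of_real \<alpha>" and b = "of_real \<beta>" and \<xi> = \<xi>]
    have "coord \<xi> 0 \<noteq> 0"
      by (rule geo(1)) (use assms(4) v2_nz \<alpha>_nz \<open>\<xi> \<noteq> 0\<close> in \<open>simp_all add: wc coord_W\<close>)
    have c: "coord \<xi> n = coord \<xi> 0 * q ^ n" for n
    proof -
      have "coord \<xi> n = coord \<xi> 0 * (\<i> * v $ 1 * \<beta> / (v $ 2 * (1 - of_real \<alpha>))) ^ n"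
        by (rule geo(2)) (use assms(4) v2_nz \<alpha>_nz \<open>\<xi> \<noteq> 0\<close> in \<open>simp_all add: wc coord_W\<close>)
      then show ?thesis by (simp add: q)
    qed
    have "summable (\<lambda>n. (cmod (coord \<xi> 0 * q ^ n))\<^sup>2)"
    proof -
      have "(\<lambda>n. (cmod (coord \<xi> n))\<^sup>2) = (\<lambda>n. (cmod (coord \<xi> 0 * q ^ n))\<^sup>2)"
        by (rule ext, rule arg_cong[where f = "\<lambda>z. (cmod z)\<^sup>2"], rule c)
      then show ?thesis using summable_coord_sq[of \<xi>] by simp
    qed
    with \<open>coord \<xi> 0 \<noteq> 0\<close> show ?thesis using geometric_square_summable_iff c[of n] by blast
  qed

  have sufficient: "\<exists>\<xi>. (\<forall>n. coord \<xi> n = of_real (sqrt (1 - (cmod q)\<^sup>2)) * q ^ n) \<and>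
      {\<phi>. pure_normal_state \<phi> \<and> invariant_state T \<phi>} = {vector_state \<xi>}"
    if "cmod q < 1"
  proof -
    define c where "c = complex_of_real (sqrt (1 - (cmod q)\<^sup>2))"
    have q2: "(cmod q)\<^sup>2 < 1" using that by (simp add: power_less_one_iff)
    then have c2: "(cmod c)\<^sup>2 = 1 - (cmod q)\<^sup>2" and "c \<noteq> 0" by (simp_all add: c_def)
    define \<xi> where "\<xi> = Abs_ell2 (\<lambda>n. c * q ^ n)"
    have \<xi>: "coord \<xi> n = c * q ^ n" for n
      unfolding \<xi>_def using geometric_square_summable_iff[OF \<open>c \<noteq> 0\<close>] that
      by (subst Abs_ell2_inverse) auto
    have n1: "norm \<xi> = 1"
    proof -
      have "(norm \<xi>)\<^sup>2 = 1" using norm_ell2_geometric[OF \<xi> that] q2 by (simp add: c2)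
      then show ?thesis by (simp add: power2_eq_1_iff) (smt (verit) norm_ge_zero)
    qed
    have "invariant_state T (vector_state \<xi>)"
    proof -
      \<comment> \<open>The second eigenvalue is forced by coordinate 0; the first is the value of
        \<open>v\<^sub>1 \<alpha> + \<i> v\<^sub>2 \<beta> q\<close>, since \<open>\<i> v\<^sub>2 \<beta> q = - v\<^sub>1 \<beta>\<^sup>2 / (1 - \<alpha>) = - v\<^sub>1 (1 + \<alpha>)\<close>.\<close>
      define w :: "2 \<Rightarrow> complex" where "w k = (if k = 1 then - v $ 1 else v $ 2)" for k
      have vq: "v $ 2 * (1 - \<alpha>) * q = \<i> * v $ 1 * \<beta>"
        using v2_nz \<alpha>_nz by (simp add: q)
      have \<beta>2: "complex_of_real \<beta> * \<beta> = (1 + \<alpha>) * (1 - \<alpha>)"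
      proof -
        have "\<beta> * \<beta> = (1 + \<alpha>) * (1 - \<alpha>)"
          using assms(3) by (simp add: algebra_simps power2_eq_square)
        then show ?thesis by (metis of_real_1 of_real_add of_real_diff of_real_mult)
      qed
      have "\<i> * v $ 2 * \<beta> * q = - v $ 1 * (1 + \<alpha>)"
      proof -
        have "(1 - \<alpha>) * (\<i> * v $ 2 * \<beta> * q) = \<i> * \<beta> * (v $ 2 * (1 - \<alpha>) * q)"
          by (simp only: mult_ac)
        also have "\<dots> = - v $ 1 * (\<beta> * \<beta>)" unfolding vq by (simp add: algebra_simps)
        also have "\<dots> = (1 - \<alpha>) * (- v $ 1 * (1 + \<alpha>))" using \<beta>2 by (simp add: mult.commute)
        finally show ?thesis
          by (rule mult_left_cancel[THEN iffD1, rotated]) (use \<alpha>_nz in simp)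
      qed
      then have 1: "v $ 1 * \<alpha> + \<i> * v $ 2 * \<beta> * q = - v $ 1" by (simp add: algebra_simps)
      have 2: "\<i> * v $ 1 * \<beta> + v $ 2 * \<alpha> * q = v $ 2 * q"
        unfolding vq[symmetric] by (simp add: algebra_simps)
      have "app (?W 1) \<xi> = w 1 *\<^sub>C \<xi>"
      proof (rule ell2_eqI)
        fix n
        have "coord (app (?W 1) \<xi>) n = (v $ 1 * \<alpha> + \<i> * v $ 2 * \<beta> * q) * (c * q ^ n)"
          unfolding coord_W \<xi> by (simp add: algebra_simps)
        then show "coord (app (?W 1) \<xi>) n = coord (w 1 *\<^sub>C \<xi>) n" by (simp only: 1) (simp add: w_def \<xi>)
      qed
      moreover have "app (?W 2) \<xi> = w 2 *\<^sub>C \<xi>"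
      proof (rule ell2_eqI)
        fix n
        show "coord (app (?W 2) \<xi>) n = coord (w 2 *\<^sub>C \<xi>) n"
        proof (cases n)
          case (Suc m)
          have "coord (app (?W 2) \<xi>) n = (\<i> * v $ 1 * \<beta> + v $ 2 * \<alpha> * q) * (c * q ^ m)"
            unfolding Suc coord_W \<xi> by (simp add: algebra_simps)
          then show ?thesis by (simp only: 2) (simp add: w_def \<xi> Suc)
        qed (simp add: coord_W w_def)
      qed
      moreover have "(\<Sum>k\<in>UNIV. (cmod (w k))\<^sup>2) = 1"
        using assms(9-11) by (simp add: sum_2 w_def v1 v2 norm_mult)
      ultimately show ?thesis
        using inv_iff[OF n1] by (auto intro!: exI[of _ w] simp: forall_2)
    qed
    moreover have "vector_state \<eta> = vector_state \<xi>"
      if \<eta>1: "norm \<eta> = 1" and inv: "invariant_state T (vector_state \<eta>)" for \<eta>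
    proof -
      have \<eta>: "coord \<eta> n = coord \<eta> 0 * q ^ n" for n using necessary[OF \<eta>1 inv] by blast
      \<comment> \<open>Two unit vectors with the same ratio differ by a phase, which the vector state forgets.\<close>
      have "\<eta> = (coord \<eta> 0 / c) *\<^sub>C \<xi>"
      proof (rule ell2_eqI)
        show "coord \<eta> n = coord ((coord \<eta> 0 / c) *\<^sub>C \<xi>) n" for n
          using \<eta>[of n] \<open>c \<noteq> 0\<close> by (simp add: \<xi>)
      qed
      then obtain d where d: "\<eta> = d *\<^sub>C \<xi>" by blast
      then have "cmod d = 1" using \<eta>1 n1 by (simp add: norm_scaleC_ell2)
      then show ?thesis by (simp add: fun_eq_iff d vector_state_scaleC)
    qed
    ultimately have "{\<phi>. pure_normal_state \<phi> \<and> invariant_state T \<phi>} = {vector_state \<xi>}"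
      using n1 unfolding pure_normal_state_def by blast
    then show ?thesis using \<xi> unfolding c_def by blast
  qed

  have "cmod q < 1" if "pure_normal_state \<phi>" "invariant_state T \<phi>" for \<phi>
    using that necessary by (auto simp: pure_normal_state_def)
  moreover have "\<exists>\<phi>. pure_normal_state \<phi> \<and> invariant_state T \<phi>" if "cmod q < 1"
    using sufficient[OF that] by (metis (mono_tags, lifting) mem_Collect_eq singletonI)
  ultimately show ?thesis using sufficient unfolding q_less by blast
qed

end
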